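(* Consider the generalization of Monotone bandits in which the separability assumption is removed: when arm $i$ in state $k$ is played after $t$ steps, it moves to state $j\ne k$ with probability $q^i_{kj}(t)$, where each $q^i_{kj}$ is an arbitrary monotonically non-decreasing function of $t$ with $\sum_{j\ne k}q^i_{kj}(t)\le1$. For this generalization, Whittle's LP (defined in the context) has an $\Omega(n)$ gap, i.e. its optimal value can be $\Omega(n)$ times the value of an optimal policy, even with $K=3$ states per arm.
   Context: Setting: $n$ arms; arm $i$ has a finite state set $\mathcal S_i$. At each step a policy plays at most one arm. An unplayed arm stays in its state and yields no reward. If arm $i$ is in state $k$ and is played, where $t\ge1$ is the number of steps since arm $i$ was last played, it yields reward $r^i_k\ge0$ and then moves to $j\ne k$ with probability $q^i_{kj}(t)$, staying in $k$ otherwise; arms transition independently. The policy may choose the starting state of each arm; the value of a policy is its infinite-horizon time-average expected reward. Whittle's LP for this setting, with variables $x^i_{kt}\ge0$ ($i$ an arm, $k\in\mathcal S_i$, $t\ge1$): maximize $\sum_i\sum_{k\in\mathcal S_i}\sum_{t\ge1}r^i_kx^i_{kt}$ subject to $\sum_i\sum_k\sum_tx^i_{kt}\le1$; $\sum_k\sum_t t\,x^i_{kt}\le1$ for all $i$; $\sum_{j\ne k}\sum_{t\ge1}x^i_{kt}q^i_{kj}(t)=\sum_{j\ne k}\sum_{t\ge1}x^i_{jt}q^i_{jk}(t)$ for all $i$ and $k\in\mathcal S_i$. *)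

theory Defs
  imports "HOL-Probability.Probability"
begin

record bandit =
  narms :: nat
  states :: "nat \<Rightarrow> nat set"
  rwd :: "nat \<Rightarrow> nat \<Rightarrow> real"
  trans_prob :: "nat \<Rightarrow> nat \<Rightarrow> nat \<Rightarrow> nat \<Rightarrow> real"

text \<open>
  Arms are the numbers below \<open>narms B\<close>; \<open>trans_prob B i k j t\<close> is $q^i_{kj}(t)$ and is only
  meaningful for distinct states $j$, $k$ of arm $i$ and for $t \ge 1$.
\<close>

definition monotone_bandit :: "bandit \<Rightarrow> bool" where
  "monotone_bandit B \<longleftrightarrow>
    (\<forall>i<narms B.
       finite (states B i) \<and> states B i \<noteq> {} \<and>
       (\<forall>k\<in>states B i.
          0 \<le> rwd B i k \<and>
          (\<forall>j\<in>states B i - {k}. \<forall>t\<ge>1. 0 \<le> trans_prob B i k j t) \<and>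
          (\<forall>j\<in>states B i - {k}. mono_on {1..} (trans_prob B i k j)) \<and>
          (\<forall>t\<ge>1. (\<Sum>j\<in>states B i - {k}. trans_prob B i k j t) \<le> 1)))"

text \<open>
  A configuration gives, for every arm, its current state and the number of steps since it was
  last played.  An action is \<open>None\<close> (play nothing) or \<open>Some i\<close> (play arm \<open>i\<close>).
  Policies may be randomized and may depend on the whole past.
\<close>

type_synonym config = "nat \<Rightarrow> nat \<times> nat"
type_synonym history = "(config \<times> nat option) list"
type_synonym policy = "history \<Rightarrow> config \<Rightarrow> nat option pmf"

definition admissible :: "bandit \<Rightarrow> policy \<Rightarrow> bool" where
  "admissible B \<pi> \<longleftrightarrow> (\<forall>h c. set_pmf (\<pi> h c) \<subseteq> insert None (Some ` {..<narms B}))"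

text \<open>
  The model does not say what the elapsed time of an arm is before its first play.  Here it is
  part of the start configuration and hence, like the starting state, up to the policy.
\<close>

definition start_config :: "bandit \<Rightarrow> config \<Rightarrow> bool" where
  "start_config B c \<longleftrightarrow> (\<forall>i<narms B. fst (c i) \<in> states B i \<and> 1 \<le> snd (c i))"

definition next_state :: "bandit \<Rightarrow> nat \<Rightarrow> nat \<Rightarrow> nat \<Rightarrow> nat pmf" where
  "next_state B i k t = embed_pmf (\<lambda>j.
     if j \<notin> states B i then 0
     else if j = k then 1 - (\<Sum>l\<in>states B i - {k}. trans_prob B i k l t)
     else trans_prob B i k j t)"

definition age :: "config \<Rightarrow> config" where
  "age c = (\<lambda>i. (fst (c i), Suc (snd (c i))))"

fun next_config :: "bandit \<Rightarrow> config \<Rightarrow> nat option \<Rightarrow> config pmf" where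
  "next_config B c None = return_pmf (age c)"
| "next_config B c (Some i) =
     map_pmf (\<lambda>j. (age c)(i := (j, 1))) (next_state B i (fst (c i)) (snd (c i)))"

fun step_reward :: "bandit \<Rightarrow> config \<Rightarrow> nat option \<Rightarrow> real" where
  "step_reward B c None = 0"
| "step_reward B c (Some i) = rwd B i (fst (c i))"

primrec process :: "bandit \<Rightarrow> policy \<Rightarrow> config \<Rightarrow> nat \<Rightarrow> (history \<times> config) pmf" where
  "process B \<pi> c0 0 = return_pmf ([], c0)"
| "process B \<pi> c0 (Suc m) =
     bind_pmf (process B \<pi> c0 m) (\<lambda>(h, c).
       bind_pmf (\<pi> h c) (\<lambda>a.
         map_pmf (\<lambda>c'. (h @ [(c, a)], c')) (next_config B c a)))"

definition expected_reward :: "bandit \<Rightarrow> policy \<Rightarrow> config \<Rightarrow> nat \<Rightarrow> real" where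
  "expected_reward B \<pi> c0 m =
     measure_pmf.expectation
       (bind_pmf (process B \<pi> c0 m) (\<lambda>(h, c). map_pmf (step_reward B c) (\<pi> h c))) (\<lambda>x. x)"

text \<open>
  The limit of the averages need not exist for every policy; the limit superior is the convention
  most favourable to the policy.
\<close>

definition policy_value :: "bandit \<Rightarrow> policy \<Rightarrow> config \<Rightarrow> ereal" where
  "policy_value B \<pi> c0 =
     limsup (\<lambda>N. ereal ((\<Sum>m<N. expected_reward B \<pi> c0 m) / real N))"

definition opt_value :: "bandit \<Rightarrow> ereal" where
  "opt_value B =
     (SUP (\<pi>, c0) \<in> {(\<pi>, c0). admissible B \<pi> \<and> start_config B c0}. policy_value B \<pi> c0)"

text \<open>
  Summability of $t\,x^i_{kt}$ over $t$ is implicit in $\sum_k\sum_t t\,x^i_{kt}\le 1$; it has to be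
  stated because \<open>infsum\<close> is 0 on families that are not summable.  It makes all other
  sums below converge.
\<close>

definition lp_feasible :: "bandit \<Rightarrow> (nat \<Rightarrow> nat \<Rightarrow> nat \<Rightarrow> real) \<Rightarrow> bool" where
  "lp_feasible B x \<longleftrightarrow>
    (\<forall>i<narms B. \<forall>k\<in>states B i. \<forall>t\<ge>1. 0 \<le> x i k t) \<and>
    (\<forall>i<narms B. \<forall>k\<in>states B i. (\<lambda>t. real t * x i k t) summable_on {1..}) \<and>
    (\<Sum>i<narms B. \<Sum>k\<in>states B i. \<Sum>\<^sub>\<infinity>t\<in>{1..}. x i k t) \<le> 1 \<and>
    (\<forall>i<narms B. (\<Sum>k\<in>states B i. \<Sum>\<^sub>\<infinity>t\<in>{1..}. real t * x i k t) \<le> 1) \<and>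
    (\<forall>i<narms B. \<forall>k\<in>states B i.
       (\<Sum>j\<in>states B i - {k}. \<Sum>\<^sub>\<infinity>t\<in>{1..}. x i k t * trans_prob B i k j t) =
       (\<Sum>j\<in>states B i - {k}. \<Sum>\<^sub>\<infinity>t\<in>{1..}. x i j t * trans_prob B i j k t))"

definition lp_objective :: "bandit \<Rightarrow> (nat \<Rightarrow> nat \<Rightarrow> nat \<Rightarrow> real) \<Rightarrow> real" where
  "lp_objective B x =
     (\<Sum>i<narms B. \<Sum>k\<in>states B i. \<Sum>\<^sub>\<infinity>t\<in>{1..}. rwd B i k * x i k t)"

definition whittle_lp_value :: "bandit \<Rightarrow> ereal" where
  "whittle_lp_value B = (SUP x \<in> {x. lp_feasible B x}. ereal (lp_objective B x))"

end

theory Submission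
  imports Defs
begin

text \<open>
  Each arm has a waiting state 0, a good state 1 that pays 1, and an absorbing dead state 2; put
  $T = 2n$ and let $R$ be of order $n^2$.  A waiting arm becomes good with probability $1/R$ if it
  is played at least $T$ steps after its last play, but dies almost surely if it is played later
  than $T$.  A good arm falls back to waiting with probability $1/R$, but dies almost surely unless
  it is played in every step.  The LP plays every waiting arm exactly every $T$ steps and every
  good arm in every step, so that each arm earns $1/(T+1)$ and the total is at least $1/3$.  A
  policy cannot do that for two arms at once: exploiting a good arm takes about $R$ steps,
  during which all other arms become overdue.  So, up to finitely many losses of arms,
  a policy does no better than with a single arm, which gives at most $2/T$.  This is made precise
  by a bounded potential whose expected drift plus reward is at most $2/T$ in every step.
\<close>

subsection \<open>Policy values and drift\<close>

lemma integrable_pmf_bounded: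
  fixes f :: "'b \<Rightarrow> real"
  assumes "\<And>y. y \<in> set_pmf p \<Longrightarrow> \<bar>f y\<bar> \<le> C"
  shows "integrable (measure_pmf p) f"
  by (rule measure_pmf.integrable_const_bound[where B=C]) (use assms in \<open>auto simp: AE_measure_pmf_iff\<close>)

lemma abs_expectation_pmf_le:
  fixes f :: "'b \<Rightarrow> real"
  assumes "\<And>y. y \<in> set_pmf p \<Longrightarrow> \<bar>f y\<bar> \<le> C"
  shows "\<bar>measure_pmf.expectation p f\<bar> \<le> C"
proof -
  have "integrable (measure_pmf p) f"
    using assms by (rule integrable_pmf_bounded)
  then show ?thesis
    using assms by (auto simp: AE_measure_pmf_iff abs_le_iff minus_le_iff
        intro!: measure_pmf.integral_le_const measure_pmf.integral_ge_const)
qed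

lemma expectation_bind_pmf_bounded:
  fixes f :: "'b \<Rightarrow> real"
  assumes "\<And>y. y \<in> set_pmf (bind_pmf p g) \<Longrightarrow> \<bar>f y\<bar> \<le> C"
  shows "measure_pmf.expectation (bind_pmf p g) f =
    measure_pmf.expectation p (\<lambda>x. measure_pmf.expectation (g x) f)"
proof -
  \<comment> \<open>\<open>integral_bind\<close> asks for a bound on the whole space, but
    \<open>f\<close> is bounded only on the support; the truncation alters it on a null set.\<close>
  define f' where "f' y = (if \<bar>f y\<bar> \<le> C then f y else 0)" for y
  have f': "f' y = f y" if "y \<in> set_pmf (bind_pmf p g)" for y
    using assms[OF that] by (simp add: f'_def)
  have "measure_pmf.expectation (bind_pmf p g) f = measure_pmf.expectation (bind_pmf p g) f'"
    using f' by (auto simp: AE_measure_pmf_iff intro!: integral_cong_AE)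
  also have "\<dots> = measure_pmf.expectation p (\<lambda>x. measure_pmf.expectation (g x) f')"
    unfolding measure_pmf_bind
    by (rule integral_bind[where K="count_space UNIV" and B="\<bar>C\<bar>" and B'=1])
       (auto simp: f'_def measure_pmf_in_subprob_algebra)
  also have "\<dots> = measure_pmf.expectation p (\<lambda>x. measure_pmf.expectation (g x) f)"
    using f' by (force simp: AE_measure_pmf_iff intro!: integral_cong_AE)
  finally show ?thesis .
qed

lemma policy_value_le_const:
  assumes "\<And>N. (\<Sum>m<N. expected_reward B \<pi> c0 m) \<le> real N * l + M"
  shows "policy_value B \<pi> c0 \<le> ereal l"
proof -
  have "policy_value B \<pi> c0 \<le> limsup (\<lambda>N. ereal (l + M / real N))"
    unfolding policy_value_def
  proof (rule Limsup_mono, rule eventually_mono[OF eventually_gt_at_top[of 0]])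
    fix N :: nat assume "0 < N"
    then have "(\<Sum>m<N. expected_reward B \<pi> c0 m) / real N \<le> (real N * l + M) / real N"
      by (intro divide_right_mono assms) auto
    also have "\<dots> = l + M / real N"
      using \<open>0 < N\<close> by (simp add: field_simps)
    finally show "ereal ((\<Sum>m<N. expected_reward B \<pi> c0 m) / real N) \<le> ereal (l + M / real N)"
      by simp
  qed
  also have "(\<lambda>N. l + M / real N) \<longlonglongrightarrow> l"
    using tendsto_add[OF tendsto_const lim_const_over_n, of l M] by simp
  then have "limsup (\<lambda>N. ereal (l + M / real N)) = ereal l"
    by (intro lim_imp_Limsup) auto
  finally show ?thesis .
qed

lemma expected_reward_eq:
  assumes "\<And>c a. \<bar>step_reward B c a\<bar> \<le> C"
  shows "expected_reward B \<pi> c0 m =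
    measure_pmf.expectation (process B \<pi> c0 m)
      (\<lambda>(h, c). measure_pmf.expectation (\<pi> h c) (step_reward B c))"
  unfolding expected_reward_def using assms
  by (subst expectation_bind_pmf_bounded[where C=C]) (auto intro!: Bochner_Integration.integral_cong)

lemma process_invariant:
  assumes "I c0"
    and "\<And>h c a c'. I c \<Longrightarrow> a \<in> set_pmf (\<pi> h c) \<Longrightarrow> c' \<in> set_pmf (next_config B c a) \<Longrightarrow> I c'"
    and "(h, c) \<in> set_pmf (process B \<pi> c0 m)"
  shows "I c"
  using assms(3)
proof (induction m arbitrary: h c)
  case 0
  then show ?case using assms(1) by simp
next
  case (Suc m)
  then show ?case by (fastforce intro: assms(2))
qed

text \<open>A Foster-Lyapunov argument: averaging the drift inequality over the random history
  compares the expected values of \<open>W\<close> at consecutive steps, and the sum over the steps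
  telescopes. What remains of \<open>W\<close> is at most \<open>M\<close>, which vanishes in the
  time average. The invariant \<open>I\<close> confines the drift condition to configurations that
  can occur.\<close>

lemma policy_value_le_drift:
  fixes W :: "config \<Rightarrow> real"
  assumes rew: "\<And>c a. \<bar>step_reward B c a\<bar> \<le> C"
    and W: "\<And>c. 0 \<le> W c" "\<And>c. W c \<le> M"
    and I: "I c0"
      "\<And>h c a c'. I c \<Longrightarrow> a \<in> set_pmf (\<pi> h c) \<Longrightarrow> c' \<in> set_pmf (next_config B c a) \<Longrightarrow> I c'"
    and drift: "\<And>h c a. I c \<Longrightarrow> a \<in> set_pmf (\<pi> h c) \<Longrightarrow>
      step_reward B c a + measure_pmf.expectation (next_config B c a) W \<le> W c + l"
  shows "policy_value B \<pi> c0 \<le> ereal l"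
proof (rule policy_value_le_const[where M=M])
  define E where "E m = measure_pmf.expectation (process B \<pi> c0 m) (\<lambda>(h, c). W c)" for m
  have absW: "\<bar>W c\<bar> \<le> M" for c using W by simp
  have step: "expected_reward B \<pi> c0 m + E (Suc m) \<le> E m + l" for m
  proof -
    define P where "P = process B \<pi> c0 m"
    define r where "r = (\<lambda>(h, c). measure_pmf.expectation (\<pi> h c) (step_reward B c))"
    define w where "w = (\<lambda>(h, c). measure_pmf.expectation (\<pi> h c)
      (\<lambda>a. measure_pmf.expectation (next_config B c a) W))"
    have intr: "integrable P r"
      by (rule integrable_pmf_bounded[where C=C]) (auto simp: r_def intro!: abs_expectation_pmf_le rew)
    have intw: "integrable P w"
      by (rule integrable_pmf_bounded[where C=M]) (auto simp: w_def intro!: abs_expectation_pmf_le absW)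
    have intW: "integrable P (\<lambda>(h, c). W c)"
      by (rule integrable_pmf_bounded[where C=M]) (auto intro: absW)
    have "E (Suc m) = measure_pmf.expectation P w"
      unfolding E_def process.simps P_def w_def
      by (auto simp: expectation_bind_pmf_bounded[where C=M] absW split_beta
            intro!: Bochner_Integration.integral_cong)
    moreover have "expected_reward B \<pi> c0 m = measure_pmf.expectation P r"
      unfolding P_def r_def using rew by (rule expected_reward_eq)
    moreover have "measure_pmf.expectation P (\<lambda>x. r x + w x) \<le>
        measure_pmf.expectation P (\<lambda>x. (case x of (h, c) \<Rightarrow> W c) + l)"
    proof (rule integral_mono_AE)
      show "integrable P (\<lambda>x. r x + w x)" using intr intw by simp
      show "integrable P (\<lambda>x. (case x of (h, c) \<Rightarrow> W c) + l)" using intW by simp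
      show "AE x in P. r x + w x \<le> (case x of (h, c) \<Rightarrow> W c) + l"
        unfolding AE_measure_pmf_iff
      proof safe
        fix h c assume hc: "(h, c) \<in> set_pmf P"
        have "I c" using I hc unfolding P_def by (rule process_invariant)
        have i1: "integrable (\<pi> h c) (step_reward B c)"
          by (rule integrable_pmf_bounded[where C=C]) (rule rew)
        have i2: "integrable (\<pi> h c) (\<lambda>a. measure_pmf.expectation (next_config B c a) W)"
          by (rule integrable_pmf_bounded[where C=M]) (auto intro!: abs_expectation_pmf_le absW)
        have "r (h, c) + w (h, c) = measure_pmf.expectation (\<pi> h c)
          (\<lambda>a. step_reward B c a + measure_pmf.expectation (next_config B c a) W)"
          using i1 i2 by (simp add: r_def w_def)
        also have "\<dots> \<le> W c + l"
          using i1 i2 drift[OF \<open>I c\<close>]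
          by (intro measure_pmf.integral_le_const) (auto simp: AE_measure_pmf_iff)
        finally show "r (h, c) + w (h, c) \<le> W c + l" .
      qed
    qed
    ultimately show ?thesis
      using intr intw intW by (simp add: E_def P_def)
  qed
  fix N
  have "(\<Sum>m<N. expected_reward B \<pi> c0 m) + E N \<le> real N * l + E 0"
  proof (induction N)
    case (Suc N)
    then show ?case using step[of N] by (simp add: algebra_simps)
  qed simp
  moreover have "0 \<le> E N" unfolding E_def using W by (intro Bochner_Integration.integral_nonneg) auto
  moreover have "E 0 \<le> M" using W by (simp add: E_def)
  ultimately show "(\<Sum>m<N. expected_reward B \<pi> c0 m) \<le> real N * l + M" by simp
qed

lemma policy_value_eq_const:
  assumes rew: "\<And>c a. \<bar>step_reward B c a\<bar> \<le> C"
    and I: "I c0"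
      "\<And>h c a c'. I c \<Longrightarrow> a \<in> set_pmf (\<pi> h c) \<Longrightarrow> c' \<in> set_pmf (next_config B c a) \<Longrightarrow> I c'"
    and const: "\<And>h c a. I c \<Longrightarrow> a \<in> set_pmf (\<pi> h c) \<Longrightarrow> step_reward B c a = r"
  shows "policy_value B \<pi> c0 = ereal r"
proof -
  have "expected_reward B \<pi> c0 m = r" for m
  proof -
    have "measure_pmf.expectation (\<pi> h c) (step_reward B c) = r"
      if "(h, c) \<in> set_pmf (process B \<pi> c0 m)" for h c
    proof -
      have "I c" using I that by (rule process_invariant)
      then have "measure_pmf.expectation (\<pi> h c) (step_reward B c) =
          measure_pmf.expectation (\<pi> h c) (\<lambda>_. r)"
        using const by (intro integral_cong_AE) (auto simp: AE_measure_pmf_iff)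
      then show ?thesis by simp
    qed
    then have "expected_reward B \<pi> c0 m = measure_pmf.expectation (process B \<pi> c0 m) (\<lambda>_. r)"
      unfolding expected_reward_eq[OF rew]
      by (intro integral_cong_AE) (auto simp: AE_measure_pmf_iff)
    then show ?thesis by simp
  qed
  then have "policy_value B \<pi> c0 = limsup (\<lambda>N. ereal (real N * r / real N))"
    by (simp add: policy_value_def)
  also have "(\<lambda>N. real N * r / real N) \<longlonglongrightarrow> r"
    by (rule tendsto_eventually, rule eventually_mono[OF eventually_gt_at_top[of 0]]) auto
  then have "limsup (\<lambda>N. ereal (real N * r / real N)) = ereal r"
    by (intro lim_imp_Limsup) auto
  finally show ?thesis .
qed

section \<open>The transition law of a single arm\<close>

lemma monotone_bandit_next_state:
  assumes "monotone_bandit B" "i < narms B" "k \<in> states B i" "1 \<le> t"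
  shows pmf_next_state: "pmf (next_state B i k t) j =
      (if j \<notin> states B i then 0
       else if j = k then 1 - (\<Sum>l\<in>states B i - {k}. trans_prob B i k l t)
       else trans_prob B i k j t)"
    and set_pmf_next_state: "set_pmf (next_state B i k t) \<subseteq> states B i"
proof -
  define p where "p j = (if j \<notin> states B i then 0
       else if j = k then 1 - (\<Sum>l\<in>states B i - {k}. trans_prob B i k l t)
       else trans_prob B i k j t)" for j
  have fin: "finite (states B i)" using assms by (auto simp: monotone_bandit_def)
  \<comment> \<open>\<open>embed_pmf\<close> has the intended point masses only if these are
    nonnegative and sum to 1; the probability of staying is the complement of the exits.\<close>
  have nonneg: "0 \<le> p j" for j
    using assms by (auto simp: monotone_bandit_def p_def)
  have "sum p (states B i) = p k + sum p (states B i - {k})"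
    using fin assms by (simp add: sum.remove)
  also have "sum p (states B i - {k}) = (\<Sum>l\<in>states B i - {k}. trans_prob B i k l t)"
    by (intro sum.cong) (auto simp: p_def)
  finally have "sum p (states B i) = 1"
    using assms by (simp add: p_def)
  then have "(\<integral>\<^sup>+j. ennreal (p j) \<partial>count_space UNIV) = 1"
    using fin nonneg sum_ennreal[of "states B i" p]
    by (subst nn_integral_count_space'[of "states B i"]) (auto, simp add: p_def)
  then have pmf: "pmf (next_state B i k t) j = p j" for j
    using nonneg unfolding next_state_def p_def[symmetric] by (intro pmf_embed_pmf) auto
  show "pmf (next_state B i k t) j =
      (if j \<notin> states B i then 0
       else if j = k then 1 - (\<Sum>l\<in>states B i - {k}. trans_prob B i k l t)
       else trans_prob B i k j t)"
    using pmf by (simp add: p_def)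
  show "set_pmf (next_state B i k t) \<subseteq> states B i"
    using pmf by (auto simp: set_pmf_eq p_def)
qed

lemma expectation_next_state:
  assumes "monotone_bandit B" "i < narms B" "k \<in> states B i" "1 \<le> t"
  shows "measure_pmf.expectation (next_state B i k t) f =
    (1 - (\<Sum>l\<in>states B i - {k}. trans_prob B i k l t)) * f k +
    (\<Sum>j\<in>states B i - {k}. trans_prob B i k j t * f j)"
proof -
  have fin: "finite (states B i)" using assms by (auto simp: monotone_bandit_def)
  have "measure_pmf.expectation (next_state B i k t) f =
      (\<Sum>j\<in>states B i. f j * pmf (next_state B i k t) j)"
    using fin set_pmf_next_state[OF assms] by (intro integral_measure_pmf_real) auto
  also have "\<dots> = f k * pmf (next_state B i k t) k +
      (\<Sum>j\<in>states B i - {k}. f j * pmf (next_state B i k t) j)"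
    using fin assms by (simp add: sum.remove)
  finally show ?thesis
    using assms(3) by (simp add: pmf_next_state[OF assms] mult.commute)
qed

subsection \<open>The instance\<close>

text \<open>This is R: played in every step, a good arm stays good for R plays on average. The
  factor 32 is chosen so that 16 * s \<le> R: after a step, the unplayed arms have total slack s at
  most T * n = 2 * n^2.\<close>

definition mean_stay :: "nat \<Rightarrow> real" where
  "mean_stay n = 32 * (real n)\<^sup>2"

text \<open>
  The small reward of the dead state serves only to make the optimal value evidently positive.
\<close>

definition gap_bandit :: "nat \<Rightarrow> bandit" where
  "gap_bandit n = \<lparr>narms = n, states = (\<lambda>_. {0, 1, 2}),
     rwd = (\<lambda>_ k. if k = 1 then 1 else if k = 2 then 1 / real (2 * n) else 0),
     trans_prob = (\<lambda>_ k j t.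
       if k = 0 \<and> j = 1 then (if 2 * n \<le> t then 1 / mean_stay n else 0)
       else if k = 0 \<and> j = 2 then (if 2 * n < t then 1 - 1 / mean_stay n else 0)
       else if k = 1 \<and> j = 0 then 1 / mean_stay n
       else if k = 1 \<and> j = 2 then (if 1 < t then 1 - 1 / mean_stay n else 0)
       else 0)\<rparr>"

lemma gap_bandit_simps [simp]:
  "narms (gap_bandit n) = n" "states (gap_bandit n) i = {0, 1, 2}"
  "rwd (gap_bandit n) i k = (if k = 1 then 1 else if k = 2 then 1 / real (2 * n) else 0)"
  "trans_prob (gap_bandit n) i k j t =
     (if k = 0 \<and> j = 1 then (if 2 * n \<le> t then 1 / mean_stay n else 0)
      else if k = 0 \<and> j = 2 then (if 2 * n < t then 1 - 1 / mean_stay n else 0)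
      else if k = 1 \<and> j = 0 then 1 / mean_stay n
      else if k = 1 \<and> j = 2 then (if 1 < t then 1 - 1 / mean_stay n else 0)
      else 0)"
  by (simp_all add: gap_bandit_def)

lemma mean_stay_ge: "1 \<le> n \<Longrightarrow> 32 \<le> mean_stay n"
  by (simp add: mean_stay_def)

text \<open>Past its deadline an arm leaves its state with probabilities 1 / R and 1 - 1 / R, which
  just exhaust the allowed mass 1; all dependence on t is by upward jumps.\<close>

lemma monotone_gap_bandit:
  assumes "1 \<le> n"
  shows "monotone_bandit (gap_bandit n)"
  using mean_stay_ge[OF assms]
  by (auto simp: monotone_bandit_def insert_Diff_if mono_on_def)

subsection \<open>The potential\<close>

text \<open>
  The arguments \<open>z\<close>, \<open>g\<close>, \<open>l\<close> count the arms that are doomed (overdue, or good but not just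
  played), good and just played, and waiting but not overdue, respectively; \<open>s\<close> sums $T + 1$ minus
  the elapsed time over the last kind.  An arm that can be kept alive is worth \<open>4 * R\<close>, and a good
  arm also its expected total reward \<open>R\<close>.  While an arm is good, one credit \<open>4 * R\<close> is withdrawn in
  advance for the arms that will become overdue, unless no other arm is alive.  The term
  \<open>16 * s\<close> pays for the chance $1/R$ per step that this does not happen because the good arm falls
  back first, and \<open>10 * z\<close> for the chance $1/R$ that a doomed arm survives being played.
  The quotient lets a single waiting arm collect $1/T$ per step to pay for the expected gain 1 of a
  play after $T$ steps.
\<close>

definition potential :: "real \<Rightarrow> nat \<Rightarrow> nat \<Rightarrow> nat \<Rightarrow> nat \<Rightarrow> nat \<Rightarrow> real" where
  "potential R T z g l s = 10 * real z + R * real g +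
     (if 1 \<le> g then 4 * R * (if l = 0 then 1 else real l) + 16 * real s
      else 4 * R * real l + (if l = 1 then (real T + 1 - real s) / real T else 0))"

text \<open>Reduces a random transition to its likely outcome x: the rare outcome y may be better by
  as much as c * R and still adds only c in expectation.\<close>

lemma weighted_mean_le:
  fixes R x y c :: real
  assumes "0 < R" "y - x \<le> c * R"
  shows "(1 - 1 / R) * x + 1 / R * y \<le> x + c"
proof -
  have "(1 - 1 / R) * x + 1 / R * y = x + (y - x) / R"
    by (simp add: algebra_simps diff_divide_distrib)
  also have "(y - x) / R \<le> c"
    using assms by (simp add: divide_le_eq)
  finally show ?thesis by simp
qed

text \<open>
  Below, \<open>z\<close>, \<open>g\<close>, \<open>l\<close>, \<open>s\<close> refer to the arms that are not played, \<open>l\<close> and \<open>s\<close> after the step and the others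
  before it; \<open>k\<close> waiting arms become overdue in the step.
\<close>

context
  fixes R :: real and T z g l k s :: nat
  assumes R: "32 \<le> R" and T: "2 \<le> T" and sl: "real s \<le> real T * real l" and sR: "16 * real s \<le> R"
begin

text \<open>The products \<open>R * real k\<close> and \<open>R * real g\<close> count as unknowns
  in the linear arithmetic below; these bounds are what it has to know about them.\<close>

lemma arith_facts:
  "32 * real k \<le> R * real k" "32 * real g \<le> R * real g"
  "k = 0 \<or> R \<le> R * real k" "g = 0 \<or> R \<le> R * real g"
  "0 < inverse (real T)" "inverse (real T) \<le> 1" "1 / real T = inverse (real T)"
  "real s / real T \<le> real l" "0 \<le> real s / real T" "real T / real T = 1"
  using R T sl
  by (auto simp: divide_simps mult.commute[of "real T"] intro!: mult_right_mono)

text \<open>If no arm is good and none becomes overdue, only the quotient of a single waiting arm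
  can grow, by exactly 1 / T. Otherwise the loss of order R from the arms that become doomed
  outweighs their new weight 10 and the quotient.\<close>

lemma potential_idle:
  "potential R T (z + k + g) 0 l s \<le> potential R T z g (l + k) (s + l + k) + 1 / real T"
proof -
  have s0: "s = 0" if "l = 0" using sl that by simp
  consider "g = 0" "k = 0" | "g = 0" "1 \<le> k" | "1 \<le> g" by linarith
  then show ?thesis
  proof cases
    case 1
    then show ?thesis using T by (auto simp: potential_def field_simps)
  next
    case 2
    then show ?thesis
      using s0 by (auto simp: potential_def algebra_simps add_divide_distrib diff_divide_distrib;
          insert arith_facts R, linarith)
  next
    case 3
    then show ?thesis
      using s0 by (auto simp: potential_def algebra_simps add_divide_distrib diff_divide_distrib;
          insert arith_facts R, linarith)
  qed
qed

text \<open>Here a is the slack of the played arm, which returns to T. The surplus 1 is the quotient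
  collected by a lone waiting arm when it is due (a = 1); if k or g is positive, a loss of order R
  yields it as well. \<open>potential_due\<close> spends it.\<close>

lemma potential_reset:
  assumes "1 \<le> a" "a \<le> T"
  shows "potential R T (z + k + g) 0 (l + 1) (s + T) \<le>
    potential R T z g (l + k + 1) (s + l + k + a) + 1 / real T -
      (if l = 0 \<and> (1 \<le> k \<or> 1 \<le> g \<or> a = 1) then 1 else 0)"
proof -
  have s0: "s = 0" if "l = 0" using sl that by simp
  consider "g = 0" "k = 0" | "g = 0" "1 \<le> k" | "1 \<le> g" by linarith
  then show ?thesis
  proof cases
    case 1
    moreover have "real a / real T \<le> 1" using T assms by (auto simp: divide_simps)
    ultimately show ?thesis
      using assms s0 by (auto simp: potential_def algebra_simps add_divide_distrib diff_divide_distrib;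
          insert arith_facts T, linarith)
  next
    case 2
    then show ?thesis
      using s0 assms by (auto simp: potential_def algebra_simps add_divide_distrib diff_divide_distrib;
          insert arith_facts R T, linarith)
  next
    case 3
    then show ?thesis
      using s0 assms by (auto simp: potential_def algebra_simps add_divide_distrib diff_divide_distrib;
          insert arith_facts R T, linarith)
  qed
qed

lemma potential_due:
  "(1 - 1 / R) * potential R T (z + k + g) 0 (l + 1) (s + T) +
      1 / R * potential R T (z + k + g) 1 l s \<le>
    potential R T z g (l + k + 1) (s + l + k + 1) + 1 / real T"
proof -
  have s0: "s = 0" if "l = 0" using sl that by simp
  \<comment> \<open>With l = 0, becoming good gains at most R. With other waiting arms it gains
    nothing: the withdrawn credit leaves -3 * R + 16 * s, which is negative.\<close>
  have "potential R T (z + k + g) 1 l s - potential R T (z + k + g) 0 (l + 1) (s + T) \<le>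
      (if l = 0 then 1 else 0) * R"
    using s0 by (auto simp: potential_def algebra_simps add_divide_distrib diff_divide_distrib;
        insert arith_facts R T sR, linarith)
  then have "(1 - 1 / R) * potential R T (z + k + g) 0 (l + 1) (s + T) +
      1 / R * potential R T (z + k + g) 1 l s \<le>
      potential R T (z + k + g) 0 (l + 1) (s + T) + (if l = 0 then 1 else 0)"
    using R by (intro weighted_mean_le) auto
  also have "\<dots> \<le> potential R T z g (l + k + 1) (s + l + k + 1) + 1 / real T"
    using potential_reset[of 1] T by (auto split: if_splits)
  finally show ?thesis .
qed

text \<open>Compared with \<open>potential_idle\<close>, the played arm gives up its weight 10, and
  this pays for its chance 1 / R of becoming good.\<close>

lemma potential_revive_waiting:
  "(1 - 1 / R) * potential R T (z + k + g) 0 l s + 1 / R * potential R T (z + k + g) 1 l s \<le>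
    potential R T (z + 1) g (l + k) (s + l + k) + 1 / real T"
proof -
  have "(1 - 1 / R) * potential R T (z + k + g) 0 l s + 1 / R * potential R T (z + k + g) 1 l s \<le>
      potential R T (z + k + g) 0 l s + 10"
    using R by (intro weighted_mean_le)
      (auto simp: potential_def algebra_simps add_divide_distrib diff_divide_distrib;
        insert arith_facts T sR, linarith)+
  also have "\<dots> \<le> potential R T (z + 1) g (l + k) (s + l + k) + 1 / real T"
    using potential_idle by (simp add: potential_def)
  finally show ?thesis .
qed

text \<open>This case uses the whole weight 10 of the doomed arm: 9 for the chance of falling back
  and 1 for the immediate reward.\<close>

lemma potential_revive_good:
  "1 + ((1 - 1 / R) * potential R T (z + k + g) 0 l s +
      1 / R * potential R T (z + k + g) 0 (l + 1) (s + T)) \<le>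
    potential R T (z + 1) g (l + k) (s + l + k) + 1 / real T"
proof -
  have s0: "s = 0" if "l = 0" using sl that by simp
  have "potential R T (z + k + g) 0 (l + 1) (s + T) - potential R T (z + k + g) 0 l s \<le> 9 * R"
    using s0 by (auto simp: potential_def algebra_simps add_divide_distrib diff_divide_distrib;
        insert arith_facts R T sR, linarith)
  then have "(1 - 1 / R) * potential R T (z + k + g) 0 l s +
      1 / R * potential R T (z + k + g) 0 (l + 1) (s + T) \<le>
      potential R T (z + k + g) 0 l s + 9"
    using R by (intro weighted_mean_le) auto
  also have "\<dots> \<le> potential R T (z + 1) g (l + k) (s + l + k) + 1 / real T - 1"
    using potential_idle by (simp add: potential_def)
  finally show ?thesis by simp
qed

text \<open>With l = 0, falling back loses R - 1 / T, so the expected loss pays for the reward up to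
  1 / T. With l \<ge> 1, falling back restores the withdrawn credit, worth at most 3 in expectation;
  ageing releases 16 per waiting arm, which covers this and the reward.\<close>

lemma potential_good:
  "1 + ((1 - 1 / R) * potential R T (z + k + g) 1 l s +
      1 / R * potential R T (z + k + g) 0 (l + 1) (s + T)) \<le>
    potential R T z (g + 1) (l + k) (s + l + k) + 1 / real T"
proof -
  have s0: "s = 0" if "l = 0" using sl that by simp
  \<comment> \<open>Turns the difference 1 / T - R of the case l = 0 into a multiple of R, as
    \<open>weighted_mean_le\<close> requires.\<close>
  have "1 / real T \<le> R / real T" using R T by (simp add: divide_right_mono)
  then have "potential R T (z + k + g) 0 (l + 1) (s + T) - potential R T (z + k + g) 1 l s \<le>
      (if l = 0 then 1 / real T - 1 else 3) * R"
    using s0 by (auto simp: potential_def algebra_simps add_divide_distrib diff_divide_distrib;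
        insert arith_facts R T sR, linarith)
  then have "(1 - 1 / R) * potential R T (z + k + g) 1 l s +
      1 / R * potential R T (z + k + g) 0 (l + 1) (s + T) \<le>
      potential R T (z + k + g) 1 l s + (if l = 0 then 1 / real T - 1 else 3)"
    using R by (intro weighted_mean_le) auto
  also have "\<dots> \<le> potential R T z (g + 1) (l + k) (s + l + k) + 1 / real T - 1"
    using s0 by (auto simp: potential_def algebra_simps;
        insert arith_facts R, linarith)
  finally show ?thesis by simp
qed

end

subsection \<open>Bounds on the optimal value and on the LP\<close>

definition live :: "nat \<Rightarrow> nat \<times> nat \<Rightarrow> nat" where
  "live T x = of_bool (fst x = 0 \<and> snd x \<le> T)"

definition good :: "nat \<times> nat \<Rightarrow> nat" where
  "good x = of_bool (fst x = 1 \<and> snd x = 1)"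

definition doomed :: "nat \<Rightarrow> nat \<times> nat \<Rightarrow> nat" where
  "doomed T x = of_bool (fst x = 0 \<and> T < snd x \<or> fst x = 1 \<and> 1 < snd x)"

text \<open>Truncated subtraction gives overdue arms slack 0, while an arm that is exactly due still
  has slack 1.\<close>

definition slack :: "nat \<Rightarrow> nat \<times> nat \<Rightarrow> nat" where
  "slack T x = (if fst x = 0 then Suc T - snd x else 0)"

definition config_potential :: "nat \<Rightarrow> config \<Rightarrow> real" where
  "config_potential n c = potential (mean_stay n) (2 * n)
     (\<Sum>i<n. doomed (2 * n) (c i)) (\<Sum>i<n. good (c i)) (\<Sum>i<n. live (2 * n) (c i))
     (\<Sum>i<n. slack (2 * n) (c i))"

definition valid_config :: "nat \<Rightarrow> config \<Rightarrow> bool" where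
  "valid_config n c \<longleftrightarrow> (\<forall>i<n. fst (c i) \<in> {0, 1, 2} \<and> 1 \<le> snd (c i))"

text \<open>Here k counts the arms that become overdue. Each of them had slack 1, so every arm that
  was live loses exactly one unit. After ageing no elapsed time is 1, so all good arms turn
  doomed.\<close>

lemma sum_age:
  assumes "finite A" "\<And>i. i \<in> A \<Longrightarrow> 1 \<le> snd (c i)"
  obtains k where
    "(\<Sum>i\<in>A. live T (c i)) = (\<Sum>i\<in>A. live T (age c i)) + k"
    "(\<Sum>i\<in>A. slack T (c i)) = (\<Sum>i\<in>A. slack T (age c i)) + (\<Sum>i\<in>A. live T (age c i)) + k"
    "(\<Sum>i\<in>A. doomed T (age c i)) = (\<Sum>i\<in>A. doomed T (c i)) + k + (\<Sum>i\<in>A. good (c i))"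
    "(\<Sum>i\<in>A. good (age c i)) = 0"
    "(\<Sum>i\<in>A. slack T (age c i)) \<le> T * (\<Sum>i\<in>A. live T (age c i))"
    "(\<Sum>i\<in>A. slack T (age c i)) \<le> T * card A"
proof
  define k where "k = (\<Sum>i\<in>A. live T (c i) - live T (age c i))"
  show "(\<Sum>i\<in>A. live T (c i)) = (\<Sum>i\<in>A. live T (age c i)) + k"
    unfolding k_def sum.distrib[symmetric]
    by (intro sum.cong) (auto simp: live_def age_def)
  show "(\<Sum>i\<in>A. slack T (c i)) = (\<Sum>i\<in>A. slack T (age c i)) + (\<Sum>i\<in>A. live T (age c i)) + k"
    unfolding k_def sum.distrib[symmetric]
    by (intro sum.cong) (auto simp: live_def slack_def age_def)
  show "(\<Sum>i\<in>A. doomed T (age c i)) = (\<Sum>i\<in>A. doomed T (c i)) + k + (\<Sum>i\<in>A. good (c i))"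
    unfolding k_def sum.distrib[symmetric] using assms(2)
    by (intro sum.cong) (force simp: live_def doomed_def good_def age_def)+
  show "(\<Sum>i\<in>A. good (age c i)) = 0"
    using assms by (fastforce simp: good_def age_def)
  show "(\<Sum>i\<in>A. slack T (age c i)) \<le> T * (\<Sum>i\<in>A. live T (age c i))"
    unfolding sum_distrib_left by (intro sum_mono) (auto simp: slack_def live_def age_def)
  have "(\<Sum>i\<in>A. slack T (age c i)) \<le> (\<Sum>i\<in>A. T)"
    by (intro sum_mono) (auto simp: slack_def age_def)
  then show "(\<Sum>i\<in>A. slack T (age c i)) \<le> T * card A" by (simp add: mult.commute)
qed

lemma valid_config_next:
  assumes "1 \<le> n" "valid_config n c" "a \<in> insert None (Some ` {..<n})"
    and "c' \<in> set_pmf (next_config (gap_bandit n) c a)"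
  shows "valid_config n c'"
proof (cases a)
  case None
  then show ?thesis using assms by (auto simp: valid_config_def age_def)
next
  case (Some i)
  then have "i < n" using assms by auto
  then have "set_pmf (next_state (gap_bandit n) i (fst (c i)) (snd (c i))) \<subseteq> {0, 1, 2}"
    using set_pmf_next_state[OF monotone_gap_bandit[OF assms(1)], of i] assms(2)
    by (auto simp: valid_config_def)
  then show ?thesis
    using assms Some \<open>i < n\<close> by (fastforce simp: valid_config_def age_def)
qed

text \<open>The allowance 1 / n is 2 / T: one half is used by the potential inequalities, the other
  by the reward 1 / (2 * n) of a dead arm. The cases follow the state and elapsed time of the played
  arm; \<open>A\<close> holds the arms that only age.\<close>

lemma potential_drift:
  assumes n: "1 \<le> n" and c: "valid_config n c" and a: "a \<in> insert None (Some ` {..<n})"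
  shows "step_reward (gap_bandit n) c a +
    measure_pmf.expectation (next_config (gap_bandit n) c a) (config_potential n) \<le>
    config_potential n c + 1 / real n"
proof -
  define R T where "R = mean_stay n" and "T = 2 * n"
  have R: "32 \<le> R" using mean_stay_ge[OF n] by (simp add: R_def)
  have T: "2 \<le> real T" "2 \<le> T" "1 \<le> T" using n by (simp_all add: T_def)
  obtain u where u: "1 / real T = u" "1 / real n = 2 * u" "1 / (2 * real n) = u" "0 < u"
    using n by (simp add: T_def)
  define A where "A = (case a of None \<Rightarrow> {..<n} | Some i \<Rightarrow> {..<n} - {i})"
  have A: "finite A" "card A \<le> n" "A \<subseteq> {..<n}"
    using card_mono[of "{..<n}" A] by (auto simp: A_def split: option.splits)
  have c1: "1 \<le> snd (c i)" if "i < n" for i using c that by (auto simp: valid_config_def)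
  obtain k where k:
    "(\<Sum>i\<in>A. live T (c i)) = (\<Sum>i\<in>A. live T (age c i)) + k"
    "(\<Sum>i\<in>A. slack T (c i)) = (\<Sum>i\<in>A. slack T (age c i)) + (\<Sum>i\<in>A. live T (age c i)) + k"
    "(\<Sum>i\<in>A. doomed T (age c i)) = (\<Sum>i\<in>A. doomed T (c i)) + k + (\<Sum>i\<in>A. good (c i))"
    "(\<Sum>i\<in>A. good (age c i)) = 0"
    "(\<Sum>i\<in>A. slack T (age c i)) \<le> T * (\<Sum>i\<in>A. live T (age c i))"
    "(\<Sum>i\<in>A. slack T (age c i)) \<le> T * card A"
    by (rule sum_age[of A c T]) (use A c1 in \<open>blast+\<close>)
  define z g l s where "z = (\<Sum>i\<in>A. doomed T (c i))" and "g = (\<Sum>i\<in>A. good (c i))"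
    and "l = (\<Sum>i\<in>A. live T (age c i))" and "s = (\<Sum>i\<in>A. slack T (age c i))"
  note folds = z_def[symmetric] g_def[symmetric] l_def[symmetric] s_def[symmetric]
  note k = k[unfolded folds]
  have sl: "real s \<le> real T * real l" using k(5) by (metis of_nat_le_iff of_nat_mult)
  have "s \<le> T * n" using k(6) A(2) by (meson le_trans mult_le_mono2)
  then have "real s \<le> real T * real n" by (metis of_nat_le_iff of_nat_mult)
  then have sR: "16 * real s \<le> R" by (simp add: R_def T_def mean_stay_def power2_eq_square)
  note P = R T(2) sl sR
  show ?thesis
  proof (cases a)
    case None
    then have "{..<n} = A" by (simp add: A_def)
    then have "config_potential n c = potential R T z g (l + k) (s + l + k)"
      and "config_potential n (age c) = potential R T (z + k + g) 0 l s"
      using k by (simp_all add: config_potential_def R_def[symmetric] T_def[symmetric] folds)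
    then show ?thesis
      using None potential_idle[OF P, of z k g, unfolded u(1)] u(4) by (simp add: u(2))
  next
    case (Some i)
    then have i: "i < n" "A = {..<n} - {i}" using a by (auto simp: A_def)
    have split: "(\<Sum>j<n. f (d j)) = f (d i) + (\<Sum>j\<in>A. f (d j))" for f :: "nat \<times> nat \<Rightarrow> nat" and d
      using i by (simp add: sum.remove)
    have upd: "(\<Sum>j<n. f (((age c)(i := x)) j)) = f x + (\<Sum>j\<in>A. f (age c j))"
      for f :: "nat \<times> nat \<Rightarrow> nat" and x
      using i by (auto simp: sum.remove[of _ i] intro!: sum.cong)
    have now: "config_potential n c = potential R T (z + doomed T (c i)) (g + good (c i))
        (l + k + live T (c i)) (s + l + k + slack T (c i))"
      using k by (simp add: config_potential_def R_def[symmetric] T_def[symmetric] split folds add_ac)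
    have upd_potential: "config_potential n ((age c)(i := x)) = potential R T (z + k + g + doomed T x) (good x)
        (l + live T x) (s + slack T x)" for x
      using k by (simp add: config_potential_def R_def[symmetric] T_def[symmetric] upd folds add_ac
          del: fun_upd_apply)
    obtain q t where q: "c i = (q, t)" by fastforce
    have t: "1 \<le> t" "q \<in> {0, 1, 2}" using c i q by (auto simp: valid_config_def)
    have next_potential:
      "config_potential n ((age c)(i := (0, 1))) = potential R T (z + k + g) 0 (l + 1) (s + T)"
      "config_potential n ((age c)(i := (1, 1))) = potential R T (z + k + g) 1 l s"
      "config_potential n ((age c)(i := (2, 1))) = potential R T (z + k + g) 0 l s"
      using T by (simp_all add: upd_potential doomed_def good_def live_def slack_def)
    let ?E = "measure_pmf.expectation (next_config (gap_bandit n) c a) (config_potential n)"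
    have D: "{0, 1, 2} - {0} = {1, 2 :: nat}" "{0, 1, 2} - {1} = {0, 2 :: nat}" "{0, 1, 2} - {2} = {0, 1 :: nat}"
      by auto
    have E: "?E =
      (1 - (\<Sum>l\<in>{0, 1, 2} - {q}. trans_prob (gap_bandit n) i q l t)) *
        config_potential n ((age c)(i := (q, 1))) +
      (\<Sum>j\<in>{0, 1, 2} - {q}. trans_prob (gap_bandit n) i q j t *
        config_potential n ((age c)(i := (j, 1))))"
      using Some expectation_next_state[OF monotone_gap_bandit[OF n], of i q t] i t q by simp
    consider "q = 0" "t < T" | "q = 0" "t = T" | "q = 0" "T < t" | "q = 1" "t = 1" | "q = 1" "1 < t" | "q = 2"
      using t by force
    then show ?thesis
    proof cases
      case 1
      have "?E = potential R T (z + k + g) 0 (l + 1) (s + T)"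
        unfolding E 1(1) D(1) using 1
        by (simp add: next_potential[simplified] R_def[symmetric] T_def[symmetric])
      moreover have "1 \<le> Suc T - t" "Suc T - t \<le> T" using 1 t by auto
      ultimately show ?thesis
        using potential_reset[OF P, of "Suc T - t" z k g, unfolded u(1)] 1 t u(4)
        by (simp add: now Some q u(2,3) live_def doomed_def good_def slack_def of_nat_diff
            split: if_splits)
    next
      case 2
      have "?E = (1 - 1 / R) * potential R T (z + k + g) 0 (l + 1) (s + T) +
          1 / R * potential R T (z + k + g) 1 l s"
        unfolding E 2(1) D(1) using 2
        by (simp add: next_potential[simplified] R_def[symmetric] T_def[symmetric])
      then show ?thesis
        using potential_due[OF P, of z k g, unfolded u(1)] 2 t u(4)
        by (simp add: now Some q u(2,3) live_def doomed_def good_def slack_def of_nat_diff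
            split: if_splits)
    next
      case 3
      have "?E = (1 - 1 / R) * potential R T (z + k + g) 0 l s +
          1 / R * potential R T (z + k + g) 1 l s"
        unfolding E 3(1) D(1) using 3
        by (simp add: next_potential[simplified] R_def[symmetric] T_def[symmetric])
      then show ?thesis
        using potential_revive_waiting[OF P, of z k g, unfolded u(1)] 3 t u(4)
        by (simp add: now Some q u(2,3) live_def doomed_def good_def slack_def of_nat_diff
            split: if_splits)
    next
      case 4
      have "?E = (1 - 1 / R) * potential R T (z + k + g) 1 l s +
          1 / R * potential R T (z + k + g) 0 (l + 1) (s + T)"
        unfolding E 4(1) D(2) using 4
        by (simp add: next_potential[simplified] R_def[symmetric] T_def[symmetric])
      then show ?thesis
        using potential_good[OF P, of z k g, unfolded u(1)] 4 t u(4)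
        by (simp add: now Some q u(2,3) live_def doomed_def good_def slack_def of_nat_diff
            split: if_splits)
    next
      case 5
      have "?E = (1 - 1 / R) * potential R T (z + k + g) 0 l s +
          1 / R * potential R T (z + k + g) 0 (l + 1) (s + T)"
        unfolding E 5(1) D(2) using 5
        by (simp add: next_potential[simplified] R_def[symmetric] T_def[symmetric])
      then show ?thesis
        using potential_revive_good[OF P, of z k g, unfolded u(1)] 5 t u(4)
        by (simp add: now Some q u(2,3) live_def doomed_def good_def slack_def of_nat_diff
            split: if_splits)
    next
      case 6
      have "?E = potential R T (z + k + g) 0 l s"
        unfolding E 6(1) D(3) using 6
        by (simp add: next_potential[simplified] R_def[symmetric] T_def[symmetric])
      then show ?thesis
        using potential_idle[OF P, of z k g, unfolded u(1)] 6 t u(4)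
        by (simp add: now Some q u(2,3) live_def doomed_def good_def slack_def of_nat_diff
            split: if_splits)
    qed
  qed
qed

section \<open>Bounds on the optimal value\<close>

lemma config_potential_bounds:
  assumes "1 \<le> n"
  shows "0 \<le> config_potential n c"
    and "config_potential n c \<le> 10 * real n + 5 * mean_stay n * (real n + 1) + 16 * (real n * (2 * real n + 1)) + 2"
proof -
  define R T where "R = mean_stay n" and "T = 2 * n"
  define z g l s where "z = (\<Sum>i<n. doomed T (c i))" and "g = (\<Sum>i<n. good (c i))"
    and "l = (\<Sum>i<n. live T (c i))" and "s = (\<Sum>i<n. slack T (c i))"
  have eq: "config_potential n c = potential R T z g l s"
    by (simp add: config_potential_def R_def T_def z_def g_def l_def s_def)
  have R: "32 \<le> R" and T: "2 \<le> real T" using assms mean_stay_ge by (simp_all add: R_def T_def)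
  have "z \<le> (\<Sum>i<n. 1)" "g \<le> (\<Sum>i<n. 1)" "l \<le> (\<Sum>i<n. 1)" "s \<le> (\<Sum>i<n. Suc T)"
    unfolding z_def g_def l_def s_def
    by (intro sum_mono; simp add: doomed_def good_def live_def slack_def)+
  then have "real z \<le> real n" "real g \<le> real n" "real l \<le> real n" "real s \<le> real (n * Suc T)"
    unfolding of_nat_le_iff by simp_all
  then have le: "real z \<le> real n" "real g \<le> real n" "real l \<le> real n"
    "real s \<le> real n * (2 * real n + 1)"
    by (simp_all add: T_def algebra_simps)
  \<comment> \<open>For l = 1 this gives s \<le> T + 1, so the quotient in the potential is
    nonnegative even if some elapsed time is 0.\<close>
  have "s \<le> Suc T * l"
    unfolding s_def l_def sum_distrib_left by (intro sum_mono) (auto simp: slack_def live_def)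
  then have w: "0 \<le> (if l = 1 then (real T + 1 - real s) / real T else 0)"
    by auto
  have w2: "(if l = 1 then (real T + 1 - real s) / real T else 0) \<le> 2"
    using T by (auto simp: divide_le_eq)
  show "0 \<le> config_potential n c"
    using R w unfolding eq potential_def by auto
  show "config_potential n c \<le> 10 * real n + 5 * mean_stay n * (real n + 1) + 16 * (real n * (2 * real n + 1)) + 2"
  proof -
    have "R * real g \<le> R * real n"
      using R le by (intro mult_left_mono) auto
    moreover have "4 * R * real l \<le> 4 * R * (real n + 1)"
      "4 * R * (if l = 0 then 1 else real l) \<le> 4 * R * (real n + 1)"
      using R le by (auto intro!: mult_left_mono)
    moreover have "0 \<le> real n * (2 * real n + 1)" by simp
    moreover have "R * real n \<le> R * (real n + 1)" using R by simp
    ultimately show ?thesis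
      using R le w2 unfolding eq potential_def R_def[symmetric]
      by (cases "1 \<le> g"; simp only: if_True if_False; linarith)
  qed
qed

lemma opt_value_gap_bandit_le:
  assumes "1 \<le> n"
  shows "opt_value (gap_bandit n) \<le> ereal (1 / real n)"
  unfolding opt_value_def
proof (rule SUP_least, safe)
  fix \<pi> c0 assume adm: "admissible (gap_bandit n) \<pi>" and start: "start_config (gap_bandit n) c0"
  have act: "a \<in> insert None (Some ` {..<n})" if "a \<in> set_pmf (\<pi> h c)" for h c a
    using adm[unfolded admissible_def gap_bandit_simps, rule_format] that by (rule subsetD)
  show "policy_value (gap_bandit n) \<pi> c0 \<le> ereal (1 / real n)"
  proof (rule policy_value_le_drift[where I="valid_config n", OF _ config_potential_bounds[OF assms]])
    show "\<bar>step_reward (gap_bandit n) c a\<bar> \<le> 1" for c a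
      using assms by (cases a) auto
    show "valid_config n c0"
      using start by (simp add: start_config_def valid_config_def)
    show "valid_config n c'" if "valid_config n c" "a \<in> set_pmf (\<pi> h c)"
      "c' \<in> set_pmf (next_config (gap_bandit n) c a)" for h c a c'
      using valid_config_next[OF assms that(1) act[OF that(2)] that(3)] .
    show "step_reward (gap_bandit n) c a +
        measure_pmf.expectation (next_config (gap_bandit n) c a) (config_potential n)
        \<le> config_potential n c + 1 / real n" if "valid_config n c" "a \<in> set_pmf (\<pi> h c)" for h c a
      using potential_drift[OF assms that(1) act[OF that(2)]] .
  qed
qed

text \<open>Playing a dead arm forever earns 1 / (2 * n) in every step. Positivity keeps the ratio
  in the theorem from being vacuous.\<close>

lemma opt_value_gap_bandit_pos:
  assumes "1 \<le> n"
  shows "0 < opt_value (gap_bandit n)"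
proof -
  define \<pi> :: policy where "\<pi> = (\<lambda>_ _. return_pmf (Some 0))"
  define c0 :: config where "c0 = (\<lambda>_. (2, 1))"
  have absorbing: "set_pmf (next_state (gap_bandit n) 0 2 t) \<subseteq> {2}" if "1 \<le> t" for t
    using pmf_next_state[OF monotone_gap_bandit[OF assms], of 0 2 t] assms that
    by (auto simp: set_pmf_eq split: if_splits)
  have "policy_value (gap_bandit n) \<pi> c0 = ereal (1 / real (2 * n))"
  proof (rule policy_value_eq_const[where I="\<lambda>c. fst (c 0) = 2 \<and> 1 \<le> snd (c 0)" and C=1])
    show "\<bar>step_reward (gap_bandit n) c a\<bar> \<le> 1" for c a
      using assms by (cases a) auto
  next
    fix h c a c'
    assume "fst (c 0) = 2 \<and> 1 \<le> snd (c 0)" "a \<in> set_pmf (\<pi> h c)"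
      "c' \<in> set_pmf (next_config (gap_bandit n) c a)"
    then show "fst (c' 0) = 2 \<and> 1 \<le> snd (c' 0)"
      using absorbing[of "snd (c 0)"] by (auto simp: \<pi>_def)
  qed (auto simp: c0_def \<pi>_def)
  moreover have "policy_value (gap_bandit n) \<pi> c0 \<le> opt_value (gap_bandit n)"
    unfolding opt_value_def using assms
    by (intro SUP_upper2[of "(\<pi>, c0)"]) (auto simp: admissible_def start_config_def \<pi>_def c0_def)
  ultimately have "ereal (1 / real (2 * n)) \<le> opt_value (gap_bandit n)" by simp
  moreover have "0 < ereal (1 / real (2 * n))" using assms by simp
  ultimately show ?thesis by (rule less_le_trans[rotated])
qed

section \<open>A feasible point of the LP\<close>

lemma infsum_single_support:
  fixes f :: "nat \<Rightarrow> real"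
  assumes "a \<in> A" "\<And>t. t \<in> A \<Longrightarrow> t \<noteq> a \<Longrightarrow> f t = 0"
  shows "infsum f A = f a" and "f summable_on A"
proof -
  have "infsum f A = infsum f {a}" using assms by (intro infsum_cong_neutral) auto
  then show "infsum f A = f a" by simp
  show "f summable_on A"
    by (rule finite_nonzero_values_imp_summable_on, rule finite_subset[of _ "{a}"]) (use assms in auto)
qed

lemma whittle_lp_value_gap_bandit_ge:
  assumes "1 \<le> n"
  shows "ereal (1 / 3) \<le> whittle_lp_value (gap_bandit n)"
proof -
  \<comment> \<open>The mass y makes the time constraint of each arm tight: T * y + y = 1. The total
    mass is 2 * n / (2 * n + 1).\<close>
  define T y where "T = 2 * n" and "y = 1 / (real T + 1)"
  define x :: "nat \<Rightarrow> nat \<Rightarrow> nat \<Rightarrow> real" where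
    "x = (\<lambda>_ k t. if k = 0 \<and> t = T \<or> k = 1 \<and> t = 1 then y else 0)"
  have y: "0 \<le> y" "y * (real T + 1) = 1" "real n * (2 * y) \<le> 1" "1 / 3 \<le> real n * y"
    using assms by (auto simp: y_def T_def field_simps)
  have T: "1 \<le> T" using assms by (simp add: T_def)
  have weighted_mass0: "(\<Sum>\<^sub>\<infinity>t\<in>{1..}. g t * x i 0 t) = g T * y" "(\<lambda>t. g t * x i 0 t) summable_on {1..}"
    for g :: "nat \<Rightarrow> real" and i
    using infsum_single_support[of T "{1..}" "\<lambda>t. g t * x i 0 t"] T by (auto simp: x_def)
  have weighted_mass1: "(\<Sum>\<^sub>\<infinity>t\<in>{1..}. g t * x i 1 t) = g 1 * y" "(\<lambda>t. g t * x i 1 t) summable_on {1..}"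
    for g :: "nat \<Rightarrow> real" and i
    using infsum_single_support[of 1 "{1..}" "\<lambda>t. g t * x i 1 t"] T by (auto simp: x_def)
  have weighted_mass2: "x i 2 = (\<lambda>_. 0)" for i by (simp add: x_def)
  have mass: "(\<Sum>\<^sub>\<infinity>t\<in>{1..}. x i k t) = (if k = 2 then 0 else y)"
    "(\<Sum>\<^sub>\<infinity>t\<in>{1..}. real t * x i k t) = (if k = 0 then real T * y else if k = 1 then y else 0)"
    if "k \<in> {0, 1, 2}" for i k
    using that weighted_mass0(1)[of "\<lambda>_. 1" i] weighted_mass1(1)[of "\<lambda>_. 1" i] weighted_mass0(1)[of real i] weighted_mass1(1)[of real i] weighted_mass2
    by auto
  have D: "{0, 1, 2} - {0} = {1, 2 :: nat}" "{0, 1, 2} - {1} = {0, 2 :: nat}" "{0, 1, 2} - {2} = {0, 1 :: nat}"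
    by auto
  have flow: "(\<Sum>\<^sub>\<infinity>t\<in>{1..}. x i 0 t * g t) = y * g T"
    "(\<Sum>\<^sub>\<infinity>t\<in>{1..}. x i 1 t * g t) = y * g 1" "(\<Sum>\<^sub>\<infinity>t\<in>{1..}. x i 2 t * g t) = 0"
    for g :: "nat \<Rightarrow> real" and i
    using weighted_mass0(1)[of g i] weighted_mass1(1)[of g i] by (simp_all add: weighted_mass2 mult.commute)
  have "lp_feasible (gap_bandit n) x"
    unfolding lp_feasible_def
  proof (intro conjI)
    show "\<forall>i<narms (gap_bandit n). \<forall>k\<in>states (gap_bandit n) i. \<forall>t\<ge>1. 0 \<le> x i k t"
      using y by (simp add: x_def)
    show "\<forall>i<narms (gap_bandit n). \<forall>k\<in>states (gap_bandit n) i. (\<lambda>t. real t * x i k t) summable_on {1..}"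
      using weighted_mass0(2) weighted_mass1(2) weighted_mass2 by auto
    show "(\<Sum>i<narms (gap_bandit n). \<Sum>k\<in>states (gap_bandit n) i. \<Sum>\<^sub>\<infinity>t\<in>{1..}. x i k t) \<le> 1"
      using y by (simp add: mass del: One_nat_def)
    show "\<forall>i<narms (gap_bandit n). (\<Sum>k\<in>states (gap_bandit n) i. \<Sum>\<^sub>\<infinity>t\<in>{1..}. real t * x i k t) \<le> 1"
      using y(2) by (simp add: mass distrib_left mult.commute del: One_nat_def)
    \<comment> \<open>At t = T for waiting arms and t = 1 for good arms there is no flow into state
      2, and the flows between 0 and 1 are both y / R.\<close>
    show "\<forall>i<narms (gap_bandit n). \<forall>k\<in>states (gap_bandit n) i.
       (\<Sum>j\<in>states (gap_bandit n) i - {k}. \<Sum>\<^sub>\<infinity>t\<in>{1..}. x i k t * trans_prob (gap_bandit n) i k j t) =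
       (\<Sum>j\<in>states (gap_bandit n) i - {k}. \<Sum>\<^sub>\<infinity>t\<in>{1..}. x i j t * trans_prob (gap_bandit n) i j k t)"
      by (simp add: flow[simplified] flow(2)[of _ "\<lambda>_. 1 / mean_stay n", simplified] D[simplified] T_def)
  qed
  moreover have "lp_objective (gap_bandit n) x = real n * y"
    by (simp add: lp_objective_def infsum_cmult_right' mass del: One_nat_def)
  ultimately have "ereal (real n * y) \<le> whittle_lp_value (gap_bandit n)"
    unfolding whittle_lp_value_def by (metis (mono_tags) SUP_upper mem_Collect_eq)
  then show ?thesis using y(4) by (meson ereal_less_eq(3) order_trans)
qed

theorem theorem7:
  "\<exists>c::real. 0 < c \<and>
     (\<forall>n::nat. 1 \<le> n \<longrightarrow>
        (\<exists>B. monotone_bandit B \<and> narms B = n \<and>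
             (\<forall>i<n. card (states B i) = 3) \<and>
             0 < opt_value B \<and>
             ereal (c * real n) * opt_value B \<le> whittle_lp_value B))"
proof (intro exI[of _ "1 / 3"] conjI allI impI)
  fix n :: nat assume n: "1 \<le> n"
  have "ereal (1 / 3 * real n) * opt_value (gap_bandit n) \<le> ereal (1 / 3 * real n) * ereal (1 / real n)"
    using n by (intro ereal_mult_left_mono opt_value_gap_bandit_le) auto
  also have "\<dots> = ereal (1 / 3)" using n by simp
  also have "\<dots> \<le> whittle_lp_value (gap_bandit n)"
    using n by (rule whittle_lp_value_gap_bandit_ge)
  finally show "\<exists>B. monotone_bandit B \<and> narms B = n \<and>
             (\<forall>i<n. card (states B i) = 3) \<and>
             0 < opt_value B \<and>
             ereal (1 / 3 * real n) * opt_value B \<le> whittle_lp_value B"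
    using n monotone_gap_bandit opt_value_gap_bandit_pos
    by (intro exI[of _ "gap_bandit n"]) auto
qed simp

end
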